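(* Let $\hat\Sigma\in\mathbf{Q}_n$, $\hat\Sigma\succ 0$, and let $0<\delta<\delta_{max}:=\log|\mathrm{diag}^2(\hat\Sigma^{-1})\hat\Sigma|$. Consider the primal problem $$\min_{L,\Sigma\in\mathbf{Q}_n}\ \mathrm{tr}(L)\quad\text{subject to}\quad L\succeq 0,\ \Sigma-L\succeq 0,\ \mathrm{ofd}(\Sigma-L)=0,\ \Sigma\succ 0,\ 2\mathcal{D}_{KL}(\Sigma\|\hat\Sigma)\le\delta .$$ The dual problem of this primal problem is $$\max_{(\lambda,\Gamma,\Theta)\in\mathcal{C}_0}J(\lambda,\Gamma,\Theta),$$ where $$J(\lambda,\Gamma,\Theta):=\lambda\left(\log\left|\hat\Sigma^{-1}+\lambda^{-1}(\mathrm{ofd}(\Theta)-\Gamma)\right|+\log|\hat\Sigma|-\delta\right)$$ and $\mathcal{C}_0$ is defined as $$\mathcal{C}_0:=\{(\lambda,\Gamma,\Theta):\ \lambda>0,\ I+\Gamma-\mathrm{ofd}(\Theta)\succeq 0,\ \Gamma\succeq 0,\ \hat\Sigma^{-1}+\lambda^{-1}(\mathrm{ofd}(\Theta)-\Gamma)\succ 0\},$$ with $\lambda\in\mathbb{R}$ and $\Gamma,\Theta\in\mathbf{Q}_n$.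
   Context: $\mathbf{Q}_n$ is the space of real symmetric $n\times n$ matrices; $|M|$ is the determinant of $M$; $\succeq,\succ$ denote positive semidefiniteness and positive definiteness. $\mathrm{diag}^2(M)$ is the diagonal matrix with the same main diagonal as $M$; $\mathrm{ofd}(M)=M-\mathrm{diag}^2(M)$ for $M\in\mathbf{Q}_n$ (diagonal entries replaced by zero). The Kullback-Leibler divergence is $$\mathcal{D}_{KL}(\Sigma\|\hat\Sigma):=\tfrac12\left(-\log|\Sigma|+\log|\hat\Sigma|+\mathrm{tr}(\Sigma\hat\Sigma^{-1})-n\right).$$ The Lagrangian associated with the primal problem is $$\mathcal{L}(L,\Sigma,\lambda,\Lambda,\Gamma,\Theta)=\mathrm{tr}(L)+\lambda\left(-\log|\Sigma|+\log|\hat\Sigma|-n+\mathrm{tr}(\hat\Sigma^{-1}\Sigma)-\delta\right)-\mathrm{tr}(\Lambda L)-\mathrm{tr}(\Gamma(\Sigma-L))+\mathrm{tr}(\mathrm{ofd}(\Theta)(\Sigma-L)),$$ with multipliers $\lambda\in\mathbb{R}$, $\lambda\ge 0$, and $\Lambda,\Gamma,\Theta\in\mathbf{Q}_n$, $\Lambda,\Gamma\succeq 0$ (the constraint $\Sigma\succ0$ is not included in the Lagrangian). The dual function is the infimum of $\mathcal{L}$ over $L$ and $\Sigma$. It is characterized by the stationarity conditions: in $\Sigma$, $\Sigma=\lambda(\lambda\hat\Sigma^{-1}-\Gamma+\mathrm{ofd}(\Theta))^{-1}$, provided that $\lambda>0$ and $\lambda\hat\Sigma^{-1}-\Gamma+\mathrm{ofd}(\Theta)\succ0$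 (which is equivalent to requiring that the minimizing $\Sigma$ satisfies $\Sigma\succ 0$); in $L$, $I-\Lambda+\Gamma-\mathrm{ofd}(\Theta)=0$. The multiplier $\Lambda$ is eliminated through the latter condition, so that $\Lambda\succeq0$ becomes $I+\Gamma-\mathrm{ofd}(\Theta)\succeq0$. *)

theory Defs
  imports "HOL-Analysis.Analysis"
begin

definition sym_mats :: "(real^'n^'n) set" where
  "sym_mats = {M. transpose M = M}"

definition psd :: "(real^'n^'n) \<Rightarrow> bool" where
  "psd M \<longleftrightarrow> M \<in> sym_mats \<and> (\<forall>x. 0 \<le> x \<bullet> (M *v x))"

definition pd :: "(real^'n^'n) \<Rightarrow> bool" where
  "pd M \<longleftrightarrow> M \<in> sym_mats \<and> (\<forall>x. x \<noteq> 0 \<longrightarrow> 0 < x \<bullet> (M *v x))"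

definition diag2 :: "(real^'n^'n) \<Rightarrow> (real^'n^'n)" where
  "diag2 M = (\<chi> i j. if i = j then M $ i $ j else 0)"

definition ofd :: "(real^'n^'n) \<Rightarrow> (real^'n^'n)" where
  "ofd M = M - diag2 M"

definition KL_div :: "(real^'n^'n) \<Rightarrow> (real^'n^'n) \<Rightarrow> real" where
  "KL_div S Shat =
     1/2 * (- ln (det S) + ln (det Shat) + trace (S ** matrix_inv Shat) - real CARD('n))"

definition delta_max :: "(real^'n^'n) \<Rightarrow> real" where
  "delta_max Shat = ln (det (diag2 (matrix_inv Shat) ** Shat))"

text \<open>
  The constraint that \<open>\<Sigma>\<close> is positive definite gets no multiplier; it is the implicit
  domain of the problem, on which \<open>log |\<Sigma>|\<close> is defined.
\<close>

definition primal_dom :: "((real^'n^'n) \<times> (real^'n^'n)) set" where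
  "primal_dom = {(L, S). L \<in> sym_mats \<and> S \<in> sym_mats \<and> pd S}"

definition primal_feasible ::
    "(real^'n^'n) \<Rightarrow> real \<Rightarrow> ((real^'n^'n) \<times> (real^'n^'n)) set" where
  "primal_feasible Shat \<delta> =
     {(L, S). L \<in> sym_mats \<and> S \<in> sym_mats \<and>
        psd L \<and> psd (S - L) \<and> ofd (S - L) = 0 \<and> pd S \<and> 2 * KL_div S Shat \<le> \<delta>}"

definition primal_obj :: "(real^'n^'n) \<times> (real^'n^'n) \<Rightarrow> real" where
  "primal_obj = (\<lambda>(L, S). trace L)"

text \<open>Multipliers are tuples \<open>(\<lambda>, \<Lambda>, \<Gamma>, \<Theta>)\<close>; the value \<open>\<lambda> = 0\<close> is allowed.\<close>

definition multipliers ::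
    "(real \<times> (real^'n^'n) \<times> (real^'n^'n) \<times> (real^'n^'n)) set" where
  "multipliers = {(l, La, G, T). 0 \<le> l \<and> psd La \<and> psd G \<and> T \<in> sym_mats}"

definition lagrangian ::
    "(real^'n^'n) \<Rightarrow> real \<Rightarrow> (real^'n^'n) \<times> (real^'n^'n) \<Rightarrow>
     real \<times> (real^'n^'n) \<times> (real^'n^'n) \<times> (real^'n^'n) \<Rightarrow> real" where
  "lagrangian Shat \<delta> = (\<lambda>(L, S) (l, La, G, T).
     trace L
     + l * (- ln (det S) + ln (det Shat) - real CARD('n) + trace (matrix_inv Shat ** S) - \<delta>)
     - trace (La ** L) - trace (G ** (S - L)) + trace (ofd T ** (S - L)))"

definition dual_fun ::
    "(real^'n^'n) \<Rightarrow> real \<Rightarrow>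
     real \<times> (real^'n^'n) \<times> (real^'n^'n) \<times> (real^'n^'n) \<Rightarrow> ereal" where
  "dual_fun Shat \<delta> m = (INF p\<in>primal_dom. ereal (lagrangian Shat \<delta> p m))"

text \<open>
  Stationarity of the Lagrangian in \<open>L\<close> gives \<open>\<Lambda> = I + \<Gamma> - ofd \<Theta>\<close>, so \<open>\<Lambda>\<close> does not occur in \<open>J\<close>
  and its constraint becomes the first semidefiniteness condition in \<open>C0\<close>.
\<close>

definition J ::
    "(real^'n^'n) \<Rightarrow> real \<Rightarrow> real \<times> (real^'n^'n) \<times> (real^'n^'n) \<Rightarrow> real" where
  "J Shat \<delta> = (\<lambda>(l, G, T).
     l * (ln (det (matrix_inv Shat + inverse l *\<^sub>R (ofd T - G))) + ln (det Shat) - \<delta>))"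

definition C0 :: "(real^'n^'n) \<Rightarrow> (real \<times> (real^'n^'n) \<times> (real^'n^'n)) set" where
  "C0 Shat = {(l, G, T). G \<in> sym_mats \<and> T \<in> sym_mats \<and>
     0 < l \<and> psd (mat 1 + G - ofd T) \<and> psd G \<and>
     pd (matrix_inv Shat + inverse l *\<^sub>R (ofd T - G))}"

end

(*
  The Lagrangian splits into a part linear in L and a part in \<Sigma>.  The linear part is bounded
  below only if \<Lambda> = I + \<Gamma> - ofd \<Theta>; the other is minimized through
  log |A| + log |\<Sigma>| \<le> tr(A \<Sigma>) - n, with equality at \<Sigma> = A^-1, and is unbounded below
  if A is not positive definite.  At \<lambda> = 0 the dual function is at most 0, whereas
  \<delta> < \<delta>_max makes J positive somewhere on C0, so only \<lambda> > 0 matters.  Since \<delta> > 0 gives a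
  strictly feasible primal point, weak duality there bounds \<lambda>, \<Gamma> and ofd \<Theta> on superlevel
  sets of J; the dual function is upper semicontinuous as an infimum of continuous functions,
  so the maximum is attained.
*)

theory Submission
  imports Defs
begin

text \<open>The set \<open>C0\<close> has two defects that shape the attainment proof. It is not
  closed, because \<open>0 < l\<close> and definiteness are strict, so the limit of a maximizing
  sequence of \<open>J\<close> might leave it. The limit is therefore taken in
  \<open>multipliers\<close>, whose conditions are all non-strict and on which
  \<open>dual_fun\<close> is defined everywhere; its positive value at the limit then forces the
  limit back into \<open>C0\<close>. Moreover \<open>C0\<close> is unbounded in a direction that no
  estimate can control: the diagonal of \<Theta> enters neither \<open>C0\<close> nor
  \<open>J\<close>. Hence \<Theta> is replaced by \<open>ofd\<close> \<Theta> before compactness is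
  used. The threshold 0 also settles the comparison of the two problems. At \<open>l = 0\<close> the
  dual function is never computed, only bounded above, and a single point with positive
  \<open>J\<close> makes that bound sufficient. On the matrix side everything is reduced to
  eigenvalues by \<open>conj_diag\<close>, and traces of products become inner products, so that the
  semidefinite multipliers are handled by the self-duality of the cone.\<close>

section \<open>Diagonalization of symmetric matrices\<close>

text \<open>A maximizer \<open>u\<close> of the Rayleigh quotient on the unit sphere of
  \<open>V\<close> is an eigenvector: the residual \<open>w = f u - c u\<close> is orthogonal to
  \<open>u\<close>, and moving along it would raise the quotient at first order unless
  \<open>w = 0\<close>. Invariance of \<open>V\<close> keeps \<open>w\<close> in \<open>V\<close>,
  so the argument can be repeated on orthogonal complements.\<close>

lemma selfadjoint_eigenvector:
  fixes f :: "'a::euclidean_space \<Rightarrow> 'a"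
  assumes lin: "linear f" and sa: "\<And>x y. x \<bullet> f y = f x \<bullet> y"
    and V: "subspace V" and inv: "\<And>x. x \<in> V \<Longrightarrow> f x \<in> V" and nz: "v \<in> V" "v \<noteq> 0"
  obtains u c where "u \<in> V" "norm u = 1" "f u = c *\<^sub>R u"
proof -
  let ?K = "sphere 0 1 \<inter> V"
  have "compact ?K" by (intro compact_Int_closed compact_sphere closed_subspace V)
  moreover have "(1 / norm v) *\<^sub>R v \<in> ?K" using V nz by (simp add: subspace_scale)
  moreover have "continuous_on ?K (\<lambda>x. x \<bullet> f x)"
    by (intro continuous_intros linear_continuous_on_compose[OF _ lin])
  ultimately obtain u where u: "u \<in> ?K" and max: "\<And>y. y \<in> ?K \<Longrightarrow> y \<bullet> f y \<le> u \<bullet> f u"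
    using continuous_attains_sup[of ?K "\<lambda>x. x \<bullet> f x"] by blast
  define c where "c = u \<bullet> f u"
  have nu: "u \<bullet> u = 1" using u by (simp add: dot_square_norm)
  have le: "y \<bullet> f y \<le> c * (y \<bullet> y)" if "y \<in> V" for y
  proof (cases "y = 0")
    case False
    have "(1 / norm y) *\<^sub>R y \<in> ?K" using V that False by (simp add: subspace_scale)
    from max[OF this] have "(y \<bullet> f y) / (norm y * norm y) \<le> c"
      using linear_scale[OF lin] by (simp add: c_def)
    then show ?thesis using False
      by (simp add: dot_square_norm power2_eq_square divide_simps split: if_splits)
  qed simp
  define w where "w = f u - c *\<^sub>R u"
  have wV: "w \<in> V" using V inv u unfolding w_def by (simp add: subspace_diff subspace_scale)
  have wu: "w \<bullet> u = 0"
    using inner_commute[of "f u" u] unfolding w_def by (simp add: inner_diff_left nu c_def)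
  have "w \<bullet> w = w \<bullet> f u - c * (w \<bullet> u)"
    by (subst (2) w_def) (simp add: inner_diff_right)
  then have wfu: "w \<bullet> f u = w \<bullet> w" using wu by simp
  \<comment> \<open>first variation at the maximizer in the direction \<open>w\<close>\<close>
  have var: "2 * t * (w \<bullet> w) \<le> t\<^sup>2 * (c * (w \<bullet> w) - w \<bullet> f w)" for t :: real
  proof -
    have "(u + t *\<^sub>R w) \<bullet> f (u + t *\<^sub>R w) = c + 2 * t * (w \<bullet> w) + t\<^sup>2 * (w \<bullet> f w)"
      using wfu sa[of u w] inner_commute[of "f u" w]
      by (simp add: linear_add[OF lin] linear_scale[OF lin] inner_add_left inner_add_right
          c_def algebra_simps power2_eq_square)
    moreover have "(u + t *\<^sub>R w) \<bullet> (u + t *\<^sub>R w) = 1 + t\<^sup>2 * (w \<bullet> w)"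
      using wu inner_commute[of u w] nu
      by (simp add: inner_add_left inner_add_right power2_eq_square)
    moreover have "u + t *\<^sub>R w \<in> V" using V u wV by (simp add: subspace_add subspace_scale)
    ultimately show ?thesis using le[of "u + t *\<^sub>R w"] by (simp add: algebra_simps)
  qed
  have "w \<bullet> w \<le> 0"
  proof (rule ccontr)
    assume "\<not> w \<bullet> w \<le> 0"
    then have pos: "w \<bullet> w > 0" by (simp only: not_le)
    \<comment> \<open>The added 1 makes \<open>K\<close> positive. With
      \<open>t = (w \<bullet> w) / K\<close> the second-order term is at most
      \<open>t * (w \<bullet> w)\<close>, half of the first-order term.\<close>
    define K where "K = \<bar>c * (w \<bullet> w) - w \<bullet> f w\<bar> + 1"
    have K: "K > 0" "c * (w \<bullet> w) - w \<bullet> f w \<le> K" unfolding K_def by auto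
    define t where "t = (w \<bullet> w) / K"
    have t: "t > 0" unfolding t_def using pos K by simp
    have "2 * t * (w \<bullet> w) \<le> t\<^sup>2 * K"
      using var[of t] mult_left_mono[OF K(2), of "t\<^sup>2"] by simp
    also have "\<dots> = t * (w \<bullet> w)" unfolding t_def using K by (simp add: power2_eq_square)
    finally show False using t pos by simp
  qed
  then have "w = 0" by (metis inner_eq_zero_iff inner_ge_zero order_antisym)
  then show thesis using that[of u c] u unfolding w_def by auto
qed

text \<open>Deflation: by self-adjointness the orthogonal complement of the eigenvectors found so
  far is invariant, and it is nonzero while their number is below the dimension.\<close>

lemma selfadjoint_orthonormal_eigenvectors:
  fixes f :: "'a::euclidean_space \<Rightarrow> 'a"
  assumes lin: "linear f" and sa: "\<And>x y. x \<bullet> f y = f x \<bullet> y" and "k \<le> DIM('a)"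
  shows "\<exists>B. finite B \<and> card B = k \<and> pairwise orthogonal B \<and>
    (\<forall>b\<in>B. norm b = 1 \<and> (\<exists>c. f b = c *\<^sub>R b))"
  using \<open>k \<le> DIM('a)\<close>
proof (induction k)
  case 0
  show ?case by (rule exI[of _ "{}"]) auto
next
  case (Suc k)
  then obtain B where B: "finite B" "card B = k" "pairwise orthogonal B"
    "\<And>b. b \<in> B \<Longrightarrow> norm b = 1" "\<And>b. b \<in> B \<Longrightarrow> \<exists>c. f b = c *\<^sub>R b" by auto
  define V where "V = {v. \<forall>b\<in>B. b \<bullet> v = 0}"
  have V: "subspace V" unfolding V_def subspace_def by (auto simp: inner_add_right)
  have inv: "f x \<in> V" if "x \<in> V" for x
    using that B(5) sa[of _ x] unfolding V_def by fastforce
  have "dim (span B) < DIM('a)"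
    using dim_le_card'[OF B(1)] B(2) Suc.prems by simp
  then obtain v where v: "v \<noteq> 0" "\<And>y. y \<in> span B \<Longrightarrow> orthogonal v y"
    using orthogonal_to_subspace_exists[of B] by (metis dim_span)
  then have "v \<in> V" unfolding V_def by (auto simp: orthogonal_def inner_commute span_base)
  then obtain u c where u: "u \<in> V" "norm u = 1" "f u = c *\<^sub>R u"
    using selfadjoint_eigenvector[OF lin sa V inv _ v(1)] by metis
  have "u \<notin> B"
  proof
    assume "u \<in> B"
    then have "u \<bullet> u = 0" using u(1) unfolding V_def by blast
    then show False using u(2) by simp
  qed
  moreover have "pairwise orthogonal (insert u B)"
    using B(3) u(1) unfolding V_def pairwise_insert orthogonal_def
    by (auto simp: inner_commute)
  ultimately show ?case using B u by (intro exI[of _ "insert u B"]) auto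
qed

text \<open>For orthogonal \<open>Q\<close> this is the spectral form; determinant, trace, products
  and definiteness can then be read off from \<open>d\<close>.\<close>

definition conj_diag :: "(real^'n^'n) \<Rightarrow> ('n \<Rightarrow> real) \<Rightarrow> (real^'n^'n)" where
  "conj_diag Q d = Q ** (\<chi> i j. if i = j then d i else 0) ** transpose Q"

lemma conj_diag_nth: "conj_diag Q d $ i $ j = (\<Sum>k\<in>UNIV. d k * Q $ i $ k * Q $ j $ k)"
  unfolding conj_diag_def matrix_matrix_mult_def transpose_def
  by (simp add: if_distrib sum.delta cong: if_cong) (simp add: mult_ac)

lemma symmetric_conj_diag:
  fixes A :: "real^'n^'n"
  assumes "A \<in> sym_mats"
  obtains Q d where "orthogonal_matrix Q" "A = conj_diag Q d"
proof -
  have tA: "transpose A = A" using assms by (simp add: sym_mats_def)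
  have "x \<bullet> (A *v y) = (A *v x) \<bullet> y" for x y
    by (metis dot_lmul_matrix tA transpose_matrix_vector)
  from selfadjoint_orthonormal_eigenvectors[OF matrix_vector_mul_linear this, of "DIM(real^'n)"]
  obtain B where B: "finite B" "card B = CARD('n)" "pairwise orthogonal B"
    "\<And>b. b \<in> B \<Longrightarrow> norm b = 1" "\<And>b. b \<in> B \<Longrightarrow> \<exists>c. A *v b = c *\<^sub>R b" by auto
  obtain h :: "'n \<Rightarrow> real^'n" where h: "bij_betw h UNIV B"
    using finite_same_card_bij[of "UNIV::'n set" B] B by auto
  have hB: "h i \<in> B" for i using h by (auto simp: bij_betw_def)
  have hinj: "h i = h j \<longleftrightarrow> i = j" for i j using h by (auto simp: bij_betw_def inj_on_def)
  obtain d where d: "\<And>i. A *v h i = d i *\<^sub>R h i" using B(5)[OF hB] by metis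
  define Q :: "real^'n^'n" where "Q = (\<chi> i j. h j $ i)"
  define D :: "real^'n^'n" where "D = (\<chi> i j. if i = j then d i else 0)"
  have col: "column j Q = h j" for j unfolding Q_def column_def by (simp add: vec_eq_iff)
  have Q: "orthogonal_matrix Q"
    unfolding orthogonal_matrix_orthonormal_columns col
    using B(3,4) hB hinj by (auto simp: pairwise_def)
  have "A ** Q = Q ** D"
  proof -
    have "(A ** Q) $ i $ j = (A *v h j) $ i" for i j
      unfolding Q_def matrix_matrix_mult_def matrix_vector_mult_def by simp
    moreover have "(Q ** D) $ i $ j = d j * h j $ i" for i j
      unfolding Q_def D_def matrix_matrix_mult_def
      by (simp add: if_distrib sum.delta' sum.delta cong: if_cong)
    ultimately show ?thesis using d by (simp add: vec_eq_iff)
  qed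
  then have "A ** (Q ** transpose Q) = Q ** D ** transpose Q"
    by (simp add: matrix_mul_assoc)
  then have "A = conj_diag Q d"
    using Q unfolding conj_diag_def D_def orthogonal_matrix_def by simp
  with Q show thesis using that by blast
qed

lemma conj_diag_sym: "conj_diag Q d \<in> sym_mats"
  by (simp add: sym_mats_def vec_eq_iff transpose_def conj_diag_nth mult_ac)

lemma conj_diag_one: "orthogonal_matrix Q \<Longrightarrow> conj_diag Q (\<lambda>i. 1) = mat 1"
  unfolding conj_diag_def orthogonal_matrix_def by (simp add: mat_def[symmetric])

lemma conj_diag_mult:
  assumes "orthogonal_matrix Q"
  shows "conj_diag Q d ** conj_diag Q e = conj_diag Q (\<lambda>i. d i * e i)"
proof -
  let ?D = "\<lambda>d :: 'a \<Rightarrow> real. (\<chi> i j. if i = j then d i else 0) :: real^'a^'a"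
  have "(\<Sum>k\<in>UNIV. (if i = k then d i else 0) * (if k = j then e k else 0)) =
      (\<Sum>k\<in>UNIV. if i = k then d i * (if i = j then e i else 0) else 0)" for i j
    by (rule sum.cong) auto
  then have "?D d ** ?D e = ?D (\<lambda>i. d i * e i)"
    by (simp add: matrix_matrix_mult_def vec_eq_iff)
  moreover have "conj_diag Q d ** conj_diag Q e = Q ** ?D d ** (transpose Q ** Q) ** ?D e ** transpose Q"
    unfolding conj_diag_def by (simp add: matrix_mul_assoc)
  ultimately show ?thesis using assms unfolding conj_diag_def orthogonal_matrix_def
    by (simp add: matrix_mul_assoc[symmetric])
qed

lemma det_conj_diag:
  assumes "orthogonal_matrix Q" shows "det (conj_diag Q d) = prod d UNIV"
proof -
  let ?D = "(\<chi> i j. if i = j then d i else 0) :: real^'a^'a"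
  have "det (conj_diag Q d) = det ?D * det (Q ** transpose Q)"
    unfolding conj_diag_def det_mul by simp
  then show ?thesis using assms by (simp add: orthogonal_matrix_def det_diagonal)
qed

lemma trace_conj_diag:
  assumes "orthogonal_matrix Q" shows "trace (conj_diag Q d) = sum d UNIV"
proof -
  have "trace (conj_diag Q d) = trace ((\<chi> i j. if i = j then d i else 0) ** (transpose Q ** Q))"
    unfolding conj_diag_def
    by (subst matrix_mul_assoc[symmetric], subst trace_mul_sym) (simp add: matrix_mul_assoc)
  then show ?thesis using assms by (simp add: orthogonal_matrix_def trace_def)
qed

lemma inner_conj_diag:
  "x \<bullet> (conj_diag Q d *v x) = (\<Sum>k\<in>UNIV. d k * ((transpose Q *v x) $ k)\<^sup>2)"
proof -
  let ?D = "(\<chi> i j. if i = j then d i else 0) :: real^'a^'a"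
  define y where "y = transpose Q *v x"
  have "x \<bullet> (conj_diag Q d *v x) = y \<bullet> (?D *v y)"
    unfolding conj_diag_def y_def
    by (simp add: matrix_vector_mul_assoc[symmetric] dot_lmul_matrix)
  also have "?D *v y = (\<chi> k. d k * y $ k)"
    by (simp add: matrix_vector_mult_def vec_eq_iff if_distrib sum.delta if_distribR cong: if_cong)
  also have "y \<bullet> (\<chi> k. d k * y $ k) = (\<Sum>k\<in>UNIV. d k * (y $ k)\<^sup>2)"
    by (simp add: inner_vec_def power2_eq_square mult_ac)
  finally show ?thesis unfolding y_def .
qed

text \<open>The vector \<open>Q *v axis k 1\<close> is the \<open>k\<close>-th column of
  \<open>Q\<close>, a unit eigenvector for \<open>d k\<close>, so the quadratic form there returns
  the eigenvalue. This yields the sign of each \<open>d k\<close> from definiteness.\<close>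

lemma conj_diag_axis:
  assumes "orthogonal_matrix Q"
  shows "(Q *v axis k 1) \<bullet> (conj_diag Q d *v (Q *v axis k 1)) = d k"
proof -
  have *: "transpose Q *v (Q *v axis k 1) = axis k (1::real)"
    using assms by (simp only: matrix_vector_mul_assoc orthogonal_matrix_def matrix_vector_mul_lid)
  have "d i * (axis k (1::real) $ i)\<^sup>2 = (if i = k then d k else 0)" for i
    by (simp add: axis_def)
  then show ?thesis unfolding inner_conj_diag * by simp
qed

lemma psd_conj_diag_iff:
  assumes "orthogonal_matrix Q" shows "psd (conj_diag Q d) \<longleftrightarrow> (\<forall>i. 0 \<le> d i)"
proof
  show "\<forall>i. 0 \<le> d i" if "psd (conj_diag Q d)"
    using that conj_diag_axis[OF assms] unfolding psd_def by metis
  show "psd (conj_diag Q d)" if "\<forall>i. 0 \<le> d i"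
    using that unfolding psd_def inner_conj_diag by (simp add: conj_diag_sym sum_nonneg)
qed

lemma pd_conj_diag_iff:
  assumes "orthogonal_matrix Q" shows "pd (conj_diag Q d) \<longleftrightarrow> (\<forall>i. 0 < d i)"
proof
  have cancel: "transpose Q *v (Q *v x) = x" "Q *v (transpose Q *v x) = x" for x
    using assms by (simp_all only: matrix_vector_mul_assoc orthogonal_matrix_def matrix_vector_mul_lid)
  show "\<forall>i. 0 < d i" if "pd (conj_diag Q d)"
  proof
    fix i
    have "Q *v axis i 1 \<noteq> 0" using cancel(1)[of "axis i 1"] by auto
    then show "0 < d i" using that conj_diag_axis[OF assms] unfolding pd_def by metis
  qed
  show "pd (conj_diag Q d)" if pos: "\<forall>i. 0 < d i"
    unfolding pd_def
  proof (intro conjI allI impI conj_diag_sym)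
    fix x :: "real^'a" assume "x \<noteq> 0"
    then have "transpose Q *v x \<noteq> 0" using cancel(2)[of x] by force
    then obtain k where k: "(transpose Q *v x) $ k \<noteq> 0" by (auto simp: vec_eq_iff)
    show "0 < x \<bullet> (conj_diag Q d *v x)"
      unfolding inner_conj_diag
      by (rule sum_pos2[of _ k]) (use pos k in \<open>auto simp: less_imp_le simp del: transpose_matrix_vector\<close>)
  qed
qed

section \<open>Semidefinite matrices\<close>

lemma subspace_sym_mats: "subspace sym_mats"
  unfolding subspace_def sym_mats_def transpose_def by (simp add: vec_eq_iff)

lemmas sym_mats_add = subspace_add[OF subspace_sym_mats]
  and sym_mats_diff = subspace_diff[OF subspace_sym_mats]
  and sym_mats_scale = subspace_scale[OF subspace_sym_mats]
  and sym_mats_0 = subspace_0[OF subspace_sym_mats]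

lemma sym_mats_mat: "mat c \<in> sym_mats"
  by (simp add: sym_mats_def)

lemma psd_sym: "psd A \<Longrightarrow> A \<in> sym_mats"
  by (simp add: psd_def)

lemma pd_sym: "pd A \<Longrightarrow> A \<in> sym_mats"
  by (simp add: pd_def)

lemma pd_psd: "pd A \<Longrightarrow> psd A"
  unfolding pd_def psd_def by (metis inner_zero_left less_imp_le order_refl)

lemma psd_0: "psd 0"
  by (simp add: psd_def sym_mats_0)

lemma pd_mat_1: "pd (mat 1)"
  by (simp add: pd_def sym_mats_mat)

lemma psd_scale: "psd A \<Longrightarrow> 0 \<le> c \<Longrightarrow> psd (c *\<^sub>R A)"
  unfolding psd_def by (simp add: sym_mats_scale scaleR_matrix_vector_assoc[symmetric])

lemma pd_scale: "pd A \<Longrightarrow> 0 < c \<Longrightarrow> pd (c *\<^sub>R A)"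
  unfolding pd_def by (simp add: sym_mats_scale scaleR_matrix_vector_assoc[symmetric])

text \<open>Symmetry of \<open>A\<close> absorbs the transpose in the Frobenius inner product. All
  trace terms of the Lagrangian thereby become bilinear in an inner product space.\<close>

lemma trace_mult_eq_inner:
  assumes "A \<in> sym_mats" shows "trace (A ** B) = A \<bullet> B"
proof -
  have "trace (A ** B) = trace (transpose A ** B)"
    using assms by (simp add: sym_mats_def)
  also have "\<dots> = (\<Sum>i\<in>UNIV. \<Sum>k\<in>UNIV. A $ k $ i * B $ k $ i)"
    unfolding trace_def matrix_matrix_mult_def transpose_def by simp
  also have "\<dots> = A \<bullet> B" unfolding inner_vec_def by (subst sum.swap) simp
  finally show ?thesis .
qed

lemma inner_mat_1: "mat 1 \<bullet> A = trace (A :: real^'n^'n)"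
  using trace_mult_eq_inner[OF sym_mats_mat, of 1 A] by simp

text \<open>The rank-one matrix of \<open>x\<close>. It makes the quadratic form at \<open>x\<close>
  a linear functional of the matrix, and it serves as a test multiplier for semidefinite
  constraints.\<close>

definition outer :: "real^'n \<Rightarrow> real^'n^'n" where
  "outer x = (\<chi> i j. x $ i * x $ j)"

lemma inner_outer: "outer x \<bullet> A = x \<bullet> (A *v x)"
  unfolding outer_def inner_vec_def matrix_vector_mult_def
  by (simp add: sum_distrib_left mult_ac)

lemma outer_mult: "outer x *v y = (x \<bullet> y) *\<^sub>R x"
  unfolding outer_def inner_vec_def matrix_vector_mult_def
  by (simp add: vec_eq_iff sum_distrib_left mult_ac)

lemma outer_sym: "outer x \<in> sym_mats"
  by (simp add: outer_def sym_mats_def transpose_def mult.commute)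

lemma psd_outer: "psd (outer x)"
  by (simp add: psd_def outer_sym outer_mult inner_commute[of x])

lemma conj_diag_eq_sum: "conj_diag Q d = (\<Sum>k\<in>UNIV. d k *\<^sub>R outer (column k Q))"
  by (simp add: vec_eq_iff conj_diag_nth outer_def column_def mult_ac)

text \<open>The spectral form writes \<open>A\<close> as a nonnegative combination of rank-one
  matrices, and each of these pairs with \<open>B\<close> to a value of the quadratic form of
  \<open>B\<close>.\<close>

lemma psd_inner_nonneg:
  fixes A :: "real^'n^'n"
  assumes "psd A" "psd B" shows "0 \<le> A \<bullet> B"
proof -
  obtain Q d where Q: "orthogonal_matrix Q" and A: "A = conj_diag Q d"
    using symmetric_conj_diag[OF psd_sym[OF assms(1)]] by blast
  have "A \<bullet> B = (\<Sum>k\<in>UNIV. d k * (column k Q \<bullet> (B *v column k Q)))"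
    unfolding A conj_diag_eq_sum by (simp add: inner_sum_left inner_outer)
  moreover have "0 \<le> d k" for k using assms(1) psd_conj_diag_iff[OF Q] A by blast
  ultimately show ?thesis using assms(2) by (simp add: psd_def sum_nonneg)
qed

text \<open>Pairing \<open>A\<close> with the semidefinite matrix
  \<open>trace A *\<^sub>R mat 1 - A\<close> gives the squared inequality. In the compactness
  argument this turns bounds on traces of multipliers into norm bounds.\<close>

lemma psd_norm_le_trace:
  fixes A :: "real^'n^'n"
  assumes "psd A" shows "norm A \<le> trace A"
proof -
  have tr: "0 \<le> trace A"
    using psd_inner_nonneg[OF pd_psd[OF pd_mat_1] assms] by (simp add: inner_mat_1)
  have "psd (trace A *\<^sub>R mat 1 - A)" unfolding psd_def
  proof (intro conjI allI)
    show "trace A *\<^sub>R mat 1 - A \<in> sym_mats"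
      by (intro sym_mats_diff sym_mats_scale sym_mats_mat psd_sym assms)
    fix x :: "real^'n"
    \<comment> \<open>Cauchy-Schwarz makes this matrix semidefinite; its inner product with
      \<open>A\<close> is the quadratic form that has to be nonnegative.\<close>
    have "psd ((x \<bullet> x) *\<^sub>R mat 1 - outer x)" unfolding psd_def
    proof (intro conjI allI)
      show "(x \<bullet> x) *\<^sub>R mat 1 - outer x \<in> sym_mats"
        by (intro sym_mats_diff sym_mats_scale sym_mats_mat outer_sym)
      fix y :: "real^'n"
      show "0 \<le> y \<bullet> (((x \<bullet> x) *\<^sub>R mat 1 - outer x) *v y)"
        using Cauchy_Schwarz_ineq[of x y]
        by (simp add: matrix_vector_mult_diff_rdistrib scaleR_matrix_vector_assoc[symmetric]
            outer_mult inner_diff_right inner_commute[of y x] power2_eq_square)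
    qed
    from psd_inner_nonneg[OF this assms]
    show "0 \<le> x \<bullet> ((trace A *\<^sub>R mat 1 - A) *v x)"
      by (simp add: matrix_vector_mult_diff_rdistrib scaleR_matrix_vector_assoc[symmetric]
          inner_diff_left inner_diff_right inner_outer inner_mat_1 mult.commute)
  qed
  from psd_inner_nonneg[OF this assms]
  have "(norm A)\<^sup>2 \<le> (trace A)\<^sup>2"
    by (simp add: inner_diff_left inner_mat_1 power2_norm_eq_inner) (simp add: power2_eq_square)
  then show ?thesis using tr by (rule power2_le_imp_le)
qed

section \<open>Determinants, inverses and log-determinant inequalities\<close>

lemma pd_det_pos:
  fixes A :: "real^'n^'n"
  assumes "pd A" shows "0 < det A"
proof -
  obtain Q d where Q: "orthogonal_matrix Q" and A: "A = conj_diag Q d"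
    using symmetric_conj_diag[OF pd_sym[OF assms]] by blast
  then show ?thesis using assms by (simp add: pd_conj_diag_iff det_conj_diag prod_pos)
qed

text \<open>Since \<open>matrix_inv\<close> is defined by choice, an explicit inverse
  \<open>B\<close> is built from reciprocal eigenvalues, and uniqueness of inverses transfers its
  definiteness.\<close>

lemma pd_inverse:
  fixes A :: "real^'n^'n"
  assumes "pd A"
  shows "pd (matrix_inv A)" and "A ** matrix_inv A = mat 1" and "matrix_inv A ** A = mat 1"
proof -
  obtain Q d where Q: "orthogonal_matrix Q" and A: "A = conj_diag Q d"
    using symmetric_conj_diag[OF pd_sym[OF assms]] by blast
  have d: "0 < d i" for i using assms A pd_conj_diag_iff[OF Q] by blast
  then have nz: "d i \<noteq> 0" for i by (metis less_irrefl)
  define B where "B = conj_diag Q (\<lambda>i. 1 / d i)"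
  have AB: "A ** B = mat 1" "B ** A = mat 1"
    unfolding A B_def by (simp_all add: conj_diag_mult[OF Q] nz conj_diag_one[OF Q])
  then have "invertible A" unfolding invertible_def by blast
  then show *: "A ** matrix_inv A = mat 1" "matrix_inv A ** A = mat 1"
    unfolding invertible_def matrix_inv_def by (metis (mono_tags, lifting) someI_ex)+
  have "B = matrix_inv A" by (metis AB(2) *(1) matrix_mul_assoc matrix_mul_lid matrix_mul_rid)
  moreover have "pd B" unfolding B_def pd_conj_diag_iff[OF Q] using d by simp
  ultimately show "pd (matrix_inv A)" by simp
qed

lemma det_matrix_inv_pd: "pd A \<Longrightarrow> det (matrix_inv A) = inverse (det A)"
  by (metis det_I det_mul inverse_unique pd_inverse(2))

text \<open>This is \<open>ln x \<le> x - 1\<close> summed over the eigenvalues.\<close>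

lemma ln_det_le_trace:
  fixes A :: "real^'n^'n"
  assumes "pd A" shows "ln (det A) \<le> trace A - real CARD('n)"
proof -
  obtain Q d where Q: "orthogonal_matrix Q" and A: "A = conj_diag Q d"
    using symmetric_conj_diag[OF pd_sym[OF assms]] by blast
  have d: "0 < d i" for i using assms A pd_conj_diag_iff[OF Q] by blast
  have "ln (det A) = (\<Sum>i\<in>UNIV. ln (d i))"
    unfolding A det_conj_diag[OF Q] using d by (intro ln_prod finite) (metis less_irrefl)
  also have "\<dots> \<le> (\<Sum>i\<in>UNIV. d i - 1)"
    using d by (intro sum_mono ln_le_minus_one)
  also have "\<dots> = trace A - real CARD('n)"
    unfolding A trace_conj_diag[OF Q] by (simp add: sum_subtractf)
  finally show ?thesis .
qed

text \<open>The product \<open>A ** S\<close> need not be symmetric. With \<open>R\<close> the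
  square root of \<open>A\<close>, the matrix \<open>R ** S ** R\<close> is positive definite and
  has the same determinant and trace, so \<open>ln_det_le_trace\<close> applies to it.\<close>

lemma ln_det_add_le_inner:
  fixes A S :: "real^'n^'n"
  assumes "pd A" "pd S"
  shows "ln (det A) + ln (det S) \<le> A \<bullet> S - real CARD('n)"
proof -
  obtain Q d where Q: "orthogonal_matrix Q" and A: "A = conj_diag Q d"
    using symmetric_conj_diag[OF pd_sym[OF assms(1)]] by blast
  have d: "0 < d i" for i using assms A pd_conj_diag_iff[OF Q] by blast
  define R where "R = conj_diag Q (\<lambda>i. sqrt (d i))"
  have R: "pd R" unfolding R_def pd_conj_diag_iff[OF Q] using d by simp
  have RR: "R ** R = A" unfolding R_def A conj_diag_mult[OF Q]
    using d by (simp add: less_imp_le)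
  have tR: "transpose R = R" using pd_sym[OF R] by (simp add: sym_mats_def)
  have tS: "transpose S = S" using pd_sym[OF assms(2)] by (simp add: sym_mats_def)
  have "pd (R ** S ** R)" unfolding pd_def
  proof (intro conjI allI impI)
    show "R ** S ** R \<in> sym_mats"
      by (simp add: sym_mats_def matrix_transpose_mul tR tS matrix_mul_assoc)
    fix x :: "real^'n" assume "x \<noteq> 0"
    then have "R *v x \<noteq> 0" using R unfolding pd_def by (metis inner_zero_right less_irrefl)
    moreover have "x \<bullet> ((R ** S ** R) *v x) = (R *v x) \<bullet> (S *v (R *v x))"
      by (metis dot_lmul_matrix matrix_vector_mul_assoc tR transpose_matrix_vector)
    ultimately show "0 < x \<bullet> ((R ** S ** R) *v x)" using assms(2) unfolding pd_def by simp
  qed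
  from ln_det_le_trace[OF this]
  have "ln (det (R ** S ** R)) \<le> trace (R ** S ** R) - real CARD('n)" .
  moreover have "det (R ** S ** R) = det A * det S" unfolding RR[symmetric] det_mul by simp
  moreover have "trace (R ** S ** R) = A \<bullet> S"
    using trace_mul_sym[of "R ** S" R] trace_mult_eq_inner[OF pd_sym[OF assms(1)], of S]
    by (simp add: matrix_mul_assoc RR)
  ultimately show ?thesis using pd_det_pos[OF assms(1)] pd_det_pos[OF assms(2)]
    by (simp add: ln_mult)
qed

text \<open>Stretch the identity by \<open>1 + t\<close> along an eigenvector of \<open>M\<close>
  with nonpositive eigenvalue: the determinant grows at will while the pairing with \<open>M\<close>
  does not exceed its value at the identity.\<close>

lemma not_pd_direction:
  fixes M :: "real^'n^'n"
  assumes "M \<in> sym_mats" "\<not> pd M" "0 \<le> t"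
  obtains S where "pd S" "det S = 1 + t" "M \<bullet> S \<le> trace M"
proof -
  obtain Q d where Q: "orthogonal_matrix Q" and M: "M = conj_diag Q d"
    using symmetric_conj_diag[OF assms(1)] by blast
  obtain k where k: "d k \<le> 0" using assms(2) M pd_conj_diag_iff[OF Q] not_less by blast
  define s where "s i = (if i = k then 1 + t else 1)" for i
  have "d i * s i = d i + (if i = k then t * d k else 0)" for i
    by (simp add: s_def algebra_simps)
  then have "M \<bullet> conj_diag Q s = trace M + t * d k"
    unfolding trace_mult_eq_inner[OF assms(1), symmetric] unfolding M
    by (simp add: conj_diag_mult[OF Q] trace_conj_diag[OF Q] sum.distrib)
  moreover have "t * d k \<le> 0" using assms(3) k by (rule mult_nonneg_nonpos)
  moreover have "det (conj_diag Q s) = 1 + t"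
    unfolding det_conj_diag[OF Q] s_def by simp
  moreover have "pd (conj_diag Q s)" unfolding pd_conj_diag_iff[OF Q] s_def using assms(3) by simp
  ultimately show thesis using that[of "conj_diag Q s"] by simp
qed

lemma pd_lower_bound:
  fixes A :: "real^'n^'n"
  assumes "pd A"
  obtains e where "0 < e" "pd (A - e *\<^sub>R mat 1)"
proof -
  have cont: "continuous_on (sphere 0 1) (\<lambda>x. x \<bullet> (A *v x))"
    by (intro continuous_intros linear_continuous_on_compose matrix_vector_mul_linear)
  have ne: "sphere (0::real^'n) 1 \<noteq> {}" by simp
  obtain u where u: "norm u = 1" and min: "\<And>x. norm x = 1 \<Longrightarrow> u \<bullet> (A *v u) \<le> x \<bullet> (A *v x)"
    using continuous_attains_inf[OF compact_sphere ne cont] by auto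
  have "u \<noteq> 0" using u by auto
  \<comment> \<open>Half of the minimum on the unit sphere, so that the shifted matrix stays
    strictly definite.\<close>
  define e where "e = (u \<bullet> (A *v u)) / 2"
  have e: "0 < e" unfolding e_def using assms \<open>u \<noteq> 0\<close> by (simp add: pd_def)
  have "pd (A - e *\<^sub>R mat 1)" unfolding pd_def
  proof (intro conjI allI impI)
    show "A - e *\<^sub>R mat 1 \<in> sym_mats"
      by (intro sym_mats_diff sym_mats_scale sym_mats_mat pd_sym assms)
    fix x :: "real^'n" assume x: "x \<noteq> 0"
    have "2 * e \<le> ((1 / norm x) *\<^sub>R x) \<bullet> (A *v ((1 / norm x) *\<^sub>R x))"
      unfolding e_def using min[of "(1 / norm x) *\<^sub>R x"] x by simp
    also have "\<dots> = (x \<bullet> (A *v x)) / (norm x)\<^sup>2"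
      by (simp add: matrix_vector_mult_scaleR power2_eq_square)
    finally have "2 * e * (norm x)\<^sup>2 \<le> x \<bullet> (A *v x)"
      using x by (simp add: divide_simps)
    moreover have "0 < e * (norm x)\<^sup>2" using e x by simp
    ultimately show "0 < x \<bullet> ((A - e *\<^sub>R mat 1) *v x)"
      by (simp add: matrix_vector_mult_diff_rdistrib scaleR_matrix_vector_assoc[symmetric]
          inner_diff_right power2_norm_eq_inner)
  qed
  with e that show thesis by blast
qed

section \<open>Diagonal and off-diagonal parts, small perturbations, closedness\<close>

lemma diag2_add: "diag2 (A + B) = diag2 A + diag2 B"
  and diag2_scale: "diag2 (c *\<^sub>R A) = c *\<^sub>R diag2 A"
  by (simp_all add: diag2_def vec_eq_iff)

lemma ofd_scale: "ofd (c *\<^sub>R A) = c *\<^sub>R ofd A"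
  by (simp add: ofd_def diag2_scale scaleR_diff_right)

lemma ofd_0: "ofd 0 = 0"
  by (simp add: ofd_def diag2_def vec_eq_iff)

lemma ofd_ofd: "ofd (ofd A) = ofd A"
  by (simp add: ofd_def diag2_def vec_eq_iff)

lemma diag2_sym: "diag2 A \<in> sym_mats"
  by (auto simp add: diag2_def sym_mats_def transpose_def vec_eq_iff)

lemma ofd_sym: "A \<in> sym_mats \<Longrightarrow> ofd A \<in> sym_mats"
  unfolding ofd_def by (intro sym_mats_diff diag2_sym)

text \<open>\<open>ofd\<close> is an orthogonal projection, so a multiplier \<open>ofd T\<close>
  sees only the off-diagonal entries of the constraint matrix.\<close>

lemma inner_ofd: "ofd A \<bullet> B = ofd A \<bullet> ofd B"
  unfolding inner_vec_def ofd_def diag2_def by (intro sum.cong) auto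

lemma trace_ofd: "trace (ofd A) = 0"
  by (simp add: trace_def ofd_def diag2_def)

lemma pd_diag2:
  fixes A :: "real^'n^'n"
  assumes "pd A" shows "pd (diag2 A)"
proof -
  have pos: "0 < A $ i $ i" for i
  proof -
    have "axis i 1 \<bullet> (A *v axis i 1) = A $ i $ i"
      by (simp add: inner_axis' matrix_vector_mult_basis column_def)
    moreover have "axis i (1::real) \<noteq> 0" by simp
    ultimately show ?thesis using assms unfolding pd_def by metis
  qed
  have "diag2 A = conj_diag (mat 1) (\<lambda>i. A $ i $ i)"
    by (simp add: conj_diag_def diag2_def vec_eq_iff)
  then show ?thesis using pos by (simp add: pd_conj_diag_iff orthogonal_matrix_id)
qed

lemma psd_mat_1_add_small:
  fixes M :: "real^'n^'n"
  assumes "M \<in> sym_mats"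
  obtains e where "0 < e" "psd (mat 1 + e *\<^sub>R M)"
proof -
  obtain Q d where Q: "orthogonal_matrix Q" and M: "M = conj_diag Q d"
    using symmetric_conj_diag[OF assms] by blast
  \<comment> \<open>This gives \<open>e * \<bar>d i\<bar> \<le> 1\<close> for every eigenvalue; the
    1 in the denominator covers \<open>M = 0\<close>.\<close>
  define e where "e = 1 / (1 + (\<Sum>i\<in>UNIV. \<bar>d i\<bar>))"
  have pos: "0 < 1 + (\<Sum>i\<in>UNIV. \<bar>d i\<bar>)" by (smt (verit) sum_nonneg abs_ge_zero)
  then have e: "0 < e" unfolding e_def by simp
  have "mat 1 + e *\<^sub>R M = conj_diag Q (\<lambda>i. 1 + e * d i)"
    unfolding M conj_diag_one[OF Q, symmetric]
    by (simp add: vec_eq_iff conj_diag_nth sum.distrib sum_distrib_left algebra_simps)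
  moreover have "0 \<le> 1 + e * d i" for i
  proof -
    have "\<bar>d i\<bar> \<le> (\<Sum>i\<in>UNIV. \<bar>d i\<bar>)" by (rule member_le_sum) auto
    then have "e * \<bar>d i\<bar> \<le> 1" unfolding e_def using pos by (simp add: divide_simps)
    moreover have "- (e * \<bar>d i\<bar>) \<le> e * d i" using e by (simp add: abs_if)
    ultimately show ?thesis by linarith
  qed
  ultimately have "psd (mat 1 + e *\<^sub>R M)" using psd_conj_diag_iff[OF Q] by metis
  with e that show thesis by blast
qed

text \<open>By \<open>inner_outer\<close> the cone is an intersection of closed half-spaces inside a
  subspace.\<close>

lemma closed_psd: "closed {A :: real^'n^'n. psd A}"
proof -
  have "{A :: real^'n^'n. psd A} = sym_mats \<inter> (\<Inter>x. {A. 0 \<le> outer x \<bullet> A})"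
    by (auto simp: psd_def inner_outer)
  moreover have "closed (\<Inter>x::real^'n. {A. 0 \<le> outer x \<bullet> A})"
    by (intro closed_INT ballI closed_Collect_le continuous_intros)
  ultimately show ?thesis using closed_subspace[OF subspace_sym_mats] closed_Int by metis
qed

section \<open>Lagrangian and dual function\<close>

lemma lagrangian_eq_inner:
  fixes Shat :: "real^'n^'n"
  assumes "pd Shat" "La \<in> sym_mats" "G \<in> sym_mats" "T \<in> sym_mats"
  shows "lagrangian Shat \<delta> (L, S) (l, La, G, T) =
    trace L + l * (- ln (det S) + ln (det Shat) - real CARD('n) + matrix_inv Shat \<bullet> S - \<delta>)
    - La \<bullet> L - G \<bullet> (S - L) + ofd T \<bullet> (S - L)"
  unfolding lagrangian_def
  using assms by (simp add: trace_mult_eq_inner ofd_sym pd_sym[OF pd_inverse(1)])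

lemma lagrangian_eq_separated:
  fixes Shat :: "real^'n^'n"
  assumes "pd Shat" "La \<in> sym_mats" "G \<in> sym_mats" "T \<in> sym_mats"
  shows "lagrangian Shat \<delta> (L, S) (l, La, G, T) =
    (mat 1 + G - ofd T - La) \<bullet> L + l * (ln (det Shat) - real CARD('n) - \<delta>)
    + ((l *\<^sub>R matrix_inv Shat + ofd T - G) \<bullet> S - l * ln (det S))"
  unfolding lagrangian_eq_inner[OF assms] inner_mat_1[symmetric]
  by (simp add: inner_add_left inner_diff_left inner_diff_right algebra_simps)

text \<open>At a feasible point every multiplier term is nonpositive and the zero multiplier attains
  \<open>trace L\<close>. At an infeasible one the violated constraint supplies a multiplier with
  positive gain \<open>b\<close>; multipliers form a cone and the gain is homogeneous, so scaling
  drives the supremum to infinity.\<close>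

lemma SUP_lagrangian:
  fixes Shat :: "real^'n^'n"
  assumes Shat: "pd Shat" and dom: "p \<in> primal_dom"
  shows "(SUP m\<in>multipliers. ereal (lagrangian Shat \<delta> p m)) =
    (if p \<in> primal_feasible Shat \<delta> then ereal (primal_obj p) else \<infinity>)"
proof -
  obtain L S where p: "p = (L, S)" by (cases p)
  have L: "L \<in> sym_mats" and S: "S \<in> sym_mats" "pd S" using dom by (auto simp: p primal_dom_def)
  have KL: "2 * KL_div S Shat =
      - ln (det S) + ln (det Shat) - real CARD('n) + matrix_inv Shat \<bullet> S"
    using trace_mul_sym[of S "matrix_inv Shat"]
      trace_mult_eq_inner[OF pd_sym[OF pd_inverse(1)[OF Shat]], of S]
    by (simp add: KL_div_def)
  have lag: "lagrangian Shat \<delta> p (l, La, G, T) =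
      trace L + l * (2 * KL_div S Shat - \<delta>) - La \<bullet> L - G \<bullet> (S - L) + ofd T \<bullet> ofd (S - L)"
    if "(l, La, G, T) \<in> multipliers" for l La G T
    using that unfolding p multipliers_def KL inner_ofd[of T, symmetric]
    by (simp add: lagrangian_eq_inner[OF Shat] psd_sym)
  show ?thesis
  proof (cases "p \<in> primal_feasible Shat \<delta>")
    case True
    then have F: "psd L" "psd (S - L)" "ofd (S - L) = 0" "2 * KL_div S Shat \<le> \<delta>"
      by (auto simp: p primal_feasible_def)
    have "(SUP m\<in>multipliers. ereal (lagrangian Shat \<delta> p m)) = ereal (trace L)"
    proof (rule antisym)
      show "(SUP m\<in>multipliers. ereal (lagrangian Shat \<delta> p m)) \<le> ereal (trace L)"
      proof (rule SUP_least)
        fix m :: "real \<times> (real^'n^'n) \<times> (real^'n^'n) \<times> (real^'n^'n)"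
        assume m: "m \<in> multipliers"
        obtain l La G T where [simp]: "m = (l, La, G, T)" by (cases m)
        have M: "0 \<le> l" "psd La" "psd G" using m by (auto simp: multipliers_def)
        have "l * (2 * KL_div S Shat - \<delta>) \<le> 0"
          using M(1) F(4) by (intro mult_nonneg_nonpos) auto
        then show "ereal (lagrangian Shat \<delta> p m) \<le> ereal (trace L)"
          using lag m F psd_inner_nonneg[OF M(2) F(1)] psd_inner_nonneg[OF M(3) F(2)] by simp
      qed
      have z: "(0, 0, 0, 0) \<in> multipliers" by (simp add: multipliers_def psd_0 sym_mats_0)
      show "ereal (trace L) \<le> (SUP m\<in>multipliers. ereal (lagrangian Shat \<delta> p m))"
        by (rule SUP_upper2[OF z]) (simp add: lag[OF z] ofd_0)
    qed
    with True show ?thesis by (simp add: p primal_obj_def)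
  next
    case False
    have "\<exists>l La G T. (l, La, G, T) \<in> multipliers \<and>
        0 < l * (2 * KL_div S Shat - \<delta>) - La \<bullet> L - G \<bullet> (S - L) + ofd T \<bullet> ofd (S - L)"
    proof -
      consider "\<not> psd L" | "\<not> psd (S - L)" | "ofd (S - L) \<noteq> 0" | "\<delta> < 2 * KL_div S Shat"
        using False L S by (auto simp: p primal_feasible_def)
      then show ?thesis
      proof cases
        case 1
        then obtain x where "x \<bullet> (L *v x) < 0" using L by (auto simp: psd_def not_le)
        then show ?thesis
          by (intro exI[of _ 0] exI[of _ "outer x"])
            (simp add: multipliers_def psd_0 psd_outer sym_mats_0 ofd_0 inner_outer)
      next
        case 2
        then obtain x where "x \<bullet> ((S - L) *v x) < 0"
          using sym_mats_diff[OF S(1) L] by (auto simp: psd_def not_le)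
        then show ?thesis
          by (intro exI[of _ 0] exI[of _ "outer x"])
            (simp add: multipliers_def psd_0 psd_outer sym_mats_0 ofd_0 inner_outer)
      next
        case 3
        \<comment> \<open>With \<Theta> equal to \<open>S - L\<close> and the other multipliers
          zero, the gain is the squared norm of \<open>ofd (S - L)\<close>.\<close>
        then show ?thesis
          by (intro exI[of _ 0] exI[of _ "S - L"])
            (simp add: multipliers_def psd_0 sym_mats_diff[OF S(1) L])
      next
        case 4
        then show ?thesis
          by (intro exI[of _ 1] exI[of _ 0]) (simp add: multipliers_def psd_0 sym_mats_0 ofd_0)
      qed
    qed
    then obtain l La G T where m: "(l, La, G, T) \<in> multipliers" and
      "0 < l * (2 * KL_div S Shat - \<delta>) - La \<bullet> L - G \<bullet> (S - L) + ofd T \<bullet> ofd (S - L)"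
      by blast
    then obtain b where b: "0 < b" and
      b_def: "b = l * (2 * KL_div S Shat - \<delta>) - La \<bullet> L - G \<bullet> (S - L) + ofd T \<bullet> ofd (S - L)"
      by blast
    have "(SUP m\<in>multipliers. ereal (lagrangian Shat \<delta> p m)) = \<infinity>"
    proof (rule ereal_top)
      fix r :: real
      \<comment> \<open>Chosen so that \<open>trace L + t * b\<close> reaches \<open>r\<close>; the
        maximum with 0 keeps the scaled tuple a multiplier.\<close>
      define t where "t = max 0 ((r - trace L) / b)"
      have tm: "(t * l, t *\<^sub>R La, t *\<^sub>R G, t *\<^sub>R T) \<in> multipliers"
        using m by (auto simp: multipliers_def t_def intro!: psd_scale sym_mats_scale)
      have "lagrangian Shat \<delta> p (t * l, t *\<^sub>R La, t *\<^sub>R G, t *\<^sub>R T) = trace L + t * b"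
        unfolding lag[OF tm] b_def by (simp add: ofd_scale algebra_simps)
      moreover have "(r - trace L) / b * b \<le> t * b"
        using b unfolding t_def by (intro mult_right_mono) auto
      ultimately have "ereal r \<le> ereal (lagrangian Shat \<delta> p (t * l, t *\<^sub>R La, t *\<^sub>R G, t *\<^sub>R T))"
        using b by simp
      then show "ereal r \<le> (SUP m\<in>multipliers. ereal (lagrangian Shat \<delta> p m))"
        by (rule SUP_upper2[OF tm])
    qed
    with False show ?thesis by simp
  qed
qed

section \<open>Evaluation of the dual function\<close>

lemma INF_ereal_eq_MInfty:
  assumes "\<And>r. \<exists>x\<in>A. f x \<le> r" shows "(INF x\<in>A. ereal (f x)) = - \<infinity>"
  by (rule ereal_bot) (meson INF_lower2 assms ereal_less_eq(3))

lemma dual_fun_eq_J: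
  fixes Shat :: "real^'n^'n"
  assumes Shat: "pd Shat" and q: "(l, G, T) \<in> C0 Shat"
  shows "dual_fun Shat \<delta> (l, mat 1 + G - ofd T, G, T) = ereal (J Shat \<delta> (l, G, T))"
proof -
  define M where "M = matrix_inv Shat + inverse l *\<^sub>R (ofd T - G)"
  have l: "0 < l" and M: "pd M" and G: "G \<in> sym_mats" and T: "T \<in> sym_mats"
    and La: "mat 1 + G - ofd T \<in> sym_mats"
    using q psd_sym by (auto simp: C0_def M_def)
  have lM: "l *\<^sub>R matrix_inv Shat + ofd T - G = l *\<^sub>R M"
    unfolding M_def using l by (simp add: algebra_simps)
  have lag: "lagrangian Shat \<delta> (L, S) (l, mat 1 + G - ofd T, G, T) =
      l * (ln (det Shat) - \<delta> + (M \<bullet> S - real CARD('n) - ln (det S)))" for L S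
    unfolding lagrangian_eq_separated[OF Shat La G T] lM by (simp add: algebra_simps)
  have J: "J Shat \<delta> (l, G, T) = l * (ln (det Shat) - \<delta> + ln (det M))"
    by (simp add: J_def M_def algebra_simps)
  show ?thesis
  proof (rule antisym)
    \<comment> \<open>The Lagrangian no longer depends on \<open>L\<close>, so \<open>L = 0\<close>
      serves; \<open>matrix_inv M\<close> is the stationary \<Sigma> of the dual function.\<close>
    have "(0, matrix_inv M) \<in> primal_dom"
      using pd_inverse(1)[OF M] by (simp add: primal_dom_def pd_sym sym_mats_0)
    moreover have "M \<bullet> matrix_inv M = real CARD('n)"
      using trace_mult_eq_inner[OF pd_sym[OF M], of "matrix_inv M"] pd_inverse(2)[OF M]
      by (simp add: trace_I)
    then have "lagrangian Shat \<delta> (0, matrix_inv M) (l, mat 1 + G - ofd T, G, T) = J Shat \<delta> (l, G, T)"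
      unfolding lag J by (simp add: det_matrix_inv_pd[OF M] ln_inverse)
    ultimately show "dual_fun Shat \<delta> (l, mat 1 + G - ofd T, G, T) \<le> ereal (J Shat \<delta> (l, G, T))"
      unfolding dual_fun_def by (intro INF_lower2) auto
    show "ereal (J Shat \<delta> (l, G, T)) \<le> dual_fun Shat \<delta> (l, mat 1 + G - ofd T, G, T)"
      unfolding dual_fun_def
    proof (rule INF_greatest)
      fix p :: "(real^'n^'n) \<times> (real^'n^'n)" assume "p \<in> primal_dom"
      then obtain L S where p: "p = (L, S)" and S: "pd S" by (auto simp: primal_dom_def)
      have "J Shat \<delta> (l, G, T) \<le> lagrangian Shat \<delta> p (l, mat 1 + G - ofd T, G, T)"
        unfolding p lag J using ln_det_add_le_inner[OF M S] l by (intro mult_left_mono) auto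
      then show "ereal (J Shat \<delta> (l, G, T)) \<le>
          ereal (lagrangian Shat \<delta> p (l, mat 1 + G - ofd T, G, T))" by simp
    qed
  qed
qed

lemma dual_fun_eq_MInfty_L:
  fixes Shat :: "real^'n^'n"
  assumes Shat: "pd Shat" and m: "(l, La, G, T) \<in> multipliers" and ne: "La \<noteq> mat 1 + G - ofd T"
  shows "dual_fun Shat \<delta> (l, La, G, T) = - \<infinity>"
  unfolding dual_fun_def
proof (rule INF_ereal_eq_MInfty)
  fix r :: real
  have sym: "La \<in> sym_mats" "G \<in> sym_mats" "T \<in> sym_mats"
    using m by (auto simp: multipliers_def psd_sym)
  define D where "D = mat 1 + G - ofd T - La"
  \<comment> \<open>The value of the Lagrangian at \<open>L = 0\<close> and
    \<open>S = mat 1\<close>. Moving \<open>L\<close> along the nonzero coefficient \<open>D\<close>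
    changes it by \<open>t * (D \<bullet> D)\<close>, so \<open>r\<close> is hit exactly.\<close>
  define c where "c = l * (ln (det Shat) - real CARD('n) - \<delta>)
    + ((l *\<^sub>R matrix_inv Shat + ofd T - G) \<bullet> mat 1 - l * ln (det (mat 1 :: real^'n^'n)))"
  have D: "D \<in> sym_mats" unfolding D_def
    by (intro sym_mats_diff sym_mats_add sym_mats_mat ofd_sym sym)
  have "0 < D \<bullet> D" using ne unfolding D_def by auto
  moreover define t where "t = (r - c) / (D \<bullet> D)"
  ultimately have "lagrangian Shat \<delta> (t *\<^sub>R D, mat 1) (l, La, G, T) = r"
    unfolding lagrangian_eq_separated[OF Shat sym] D_def[symmetric] by (simp add: c_def)
  moreover have "(t *\<^sub>R D, mat 1) \<in> primal_dom"
    by (simp add: primal_dom_def pd_mat_1 sym_mats_mat sym_mats_scale[OF D])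
  ultimately show "\<exists>p\<in>primal_dom. lagrangian Shat \<delta> p (l, La, G, T) \<le> r" by force
qed

lemma dual_fun_eq_MInfty_S:
  fixes Shat :: "real^'n^'n"
  assumes Shat: "pd Shat" and m: "(l, La, G, T) \<in> multipliers" and l: "0 < l"
    and npd: "\<not> pd (matrix_inv Shat + inverse l *\<^sub>R (ofd T - G))"
  shows "dual_fun Shat \<delta> (l, La, G, T) = - \<infinity>"
  unfolding dual_fun_def
proof (rule INF_ereal_eq_MInfty)
  fix r :: real
  have sym: "La \<in> sym_mats" "G \<in> sym_mats" "T \<in> sym_mats"
    using m by (auto simp: multipliers_def psd_sym)
  define M where "M = l *\<^sub>R matrix_inv Shat + ofd T - G"
  have "inverse l *\<^sub>R M = matrix_inv Shat + inverse l *\<^sub>R (ofd T - G)"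
    unfolding M_def using l by (simp add: algebra_simps)
  then have "\<not> pd M" using npd l pd_scale[of M "inverse l"] by auto
  moreover have "M \<in> sym_mats" unfolding M_def
    by (intro sym_mats_diff sym_mats_add sym_mats_scale ofd_sym sym pd_sym pd_inverse(1) Shat)
  moreover define c where "c = l * (ln (det Shat) - real CARD('n) - \<delta>) + trace M"
  \<comment> \<open>\<open>s\<close> is the intended value of \<open>ln (det S)\<close>, whence the
    stretch \<open>exp s - 1\<close> below; its size makes \<open>c - l * s \<le> r\<close>.\<close>
  moreover define s where "s = max 0 ((c - r) / l)"
  moreover have "0 \<le> exp s - 1" unfolding s_def by simp
  ultimately obtain S where S: "pd S" "det S = 1 + (exp s - 1)" "M \<bullet> S \<le> trace M"
    using not_pd_direction[of M "exp s - 1"] by blast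
  have "(c - r) / l * l \<le> s * l" using l unfolding s_def by (intro mult_right_mono) auto
  then have "c - l * s \<le> r" using l by (simp add: mult.commute)
  moreover have "lagrangian Shat \<delta> (0, S) (l, La, G, T) \<le> c - l * s"
    unfolding lagrangian_eq_separated[OF Shat sym] M_def[symmetric] c_def using S by simp
  moreover have "(0, S) \<in> primal_dom"
    using S by (simp add: primal_dom_def sym_mats_0 pd_sym)
  ultimately show "\<exists>p\<in>primal_dom. lagrangian Shat \<delta> p (l, La, G, T) \<le> r"
    by (meson order_trans)
qed

lemma dual_fun_pos_multiplier:
  fixes Shat :: "real^'n^'n"
  assumes Shat: "pd Shat" and m: "(l, La, G, T) \<in> multipliers" and l: "0 < l"
  shows "dual_fun Shat \<delta> (l, La, G, T) =
    (if (l, G, T) \<in> C0 Shat \<and> La = mat 1 + G - ofd T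
     then ereal (J Shat \<delta> (l, G, T)) else - \<infinity>)"
proof (cases "La = mat 1 + G - ofd T")
  case True
  show ?thesis
  proof (cases "pd (matrix_inv Shat + inverse l *\<^sub>R (ofd T - G))")
    case pd: True
    have "(l, G, T) \<in> C0 Shat"
      using m l pd True by (auto simp: C0_def multipliers_def psd_sym)
    then show ?thesis using dual_fun_eq_J[OF Shat] True by simp
  next
    case False
    then have "(l, G, T) \<notin> C0 Shat" by (simp add: C0_def)
    then show ?thesis using dual_fun_eq_MInfty_S[OF Shat m l False] by simp
  qed
next
  case False
  then show ?thesis using dual_fun_eq_MInfty_L[OF Shat m False] by simp
qed

text \<open>At \<open>L = 0\<close> and \<open>S = mat 1\<close> only the pairing of
  \<open>ofd T - G\<close> with the identity is left, which is \<open>- trace G\<close> because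
  \<open>ofd T\<close> has zero trace.\<close>

lemma dual_fun_zero_multiplier:
  fixes Shat :: "real^'n^'n"
  assumes Shat: "pd Shat" and m: "(0, La, G, T) \<in> multipliers"
  shows "dual_fun Shat \<delta> (0, La, G, T) \<le> 0"
proof -
  have sym: "La \<in> sym_mats" "G \<in> sym_mats" "T \<in> sym_mats" and G: "psd G"
    using m by (auto simp: multipliers_def psd_sym)
  have "(0, mat 1) \<in> primal_dom" by (simp add: primal_dom_def sym_mats_0 sym_mats_mat pd_mat_1)
  moreover have "lagrangian Shat \<delta> (0, mat 1) (0, La, G, T) \<le> 0"
    using psd_inner_nonneg[OF pd_psd[OF pd_mat_1] G]
    unfolding lagrangian_eq_separated[OF Shat sym]
    by (simp add: inner_commute[of _ "mat 1"] inner_mat_1 trace_ofd trace_sub)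
  ultimately show ?thesis unfolding dual_fun_def zero_ereal_def
    by (intro INF_lower2) auto
qed

section \<open>Positivity, boundedness and attainment of the maximum\<close>

lemma C0_multiplier: "(l, G, T) \<in> C0 Shat \<Longrightarrow> (l, mat 1 + G - ofd T, G, T) \<in> multipliers"
  by (auto simp: C0_def multipliers_def)

text \<open>With \<open>\<Theta> = - \<lambda> Shat\<inverse>\<close> and \<open>\<Gamma> = 0\<close> the off-diagonal part of \<open>Shat\<inverse>\<close> cancels, leaving
  \<open>J = \<lambda> (delta_max Shat - \<delta>)\<close>; small \<open>\<lambda>\<close> keeps \<open>I - ofd \<Theta>\<close> semidefinite.\<close>

lemma J_pos_exists:
  fixes Shat :: "real^'n^'n"
  assumes Shat: "pd Shat" and "\<delta> < delta_max Shat"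
  obtains q where "q \<in> C0 Shat" "0 < J Shat \<delta> q"
proof -
  let ?P = "matrix_inv Shat"
  have P: "pd ?P" by (rule pd_inverse(1)[OF Shat])
  obtain l where l: "0 < l" "psd (mat 1 + l *\<^sub>R ofd ?P)"
    using psd_mat_1_add_small[OF ofd_sym[OF pd_sym[OF P]]] by blast
  define T where "T = (- l) *\<^sub>R ?P"
  have T: "T \<in> sym_mats" "ofd T = - l *\<^sub>R ofd ?P"
    unfolding T_def ofd_scale by (rule sym_mats_scale[OF pd_sym[OF P]]) simp
  have eq: "?P + inverse l *\<^sub>R (ofd T - 0) = diag2 ?P"
    using l unfolding T(2) by (simp add: ofd_def)
  have "(l, 0, T) \<in> C0 Shat"
    unfolding C0_def using l T pd_diag2[OF P] eq by (simp add: sym_mats_0 psd_0)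
  moreover have "J Shat \<delta> (l, 0, T) = l * (delta_max Shat - \<delta>)"
    unfolding J_def delta_max_def prod.case eq
    using pd_det_pos[OF Shat] pd_det_pos[OF pd_diag2[OF P]]
    by (simp add: det_mul ln_mult)
  ultimately show thesis using that l assms(2) by simp
qed

text \<open>Weak duality at the strictly feasible point \<open>(Shat - e I, Shat)\<close> bounds the multipliers.\<close>

lemma superlevel_bounded:
  fixes Shat :: "real^'n^'n"
  assumes Shat: "pd Shat" and \<delta>: "0 < \<delta>"
  obtains B where "\<And>l G T. (l, G, T) \<in> C0 Shat \<Longrightarrow> 0 \<le> J Shat \<delta> (l, G, T) \<Longrightarrow>
    J Shat \<delta> (l, G, T) \<le> B \<and> l \<le> B \<and> norm G \<le> B \<and> norm (ofd T) \<le> B"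
proof -
  obtain e where e: "0 < e" and L: "pd (Shat - e *\<^sub>R mat 1)" using pd_lower_bound[OF Shat] by blast
  define L where "L = Shat - e *\<^sub>R mat 1"
  \<comment> \<open>A second margin, now for \<open>L\<close> itself: it turns
    \<open>La \<bullet> L\<close> into a bound on \<open>trace La\<close>.\<close>
  obtain f where f: "0 < f" and "pd (L - f *\<^sub>R mat 1)"
    using pd_lower_bound L unfolding L_def by blast
  then have Lf: "psd (L - f *\<^sub>R mat 1)" by (simp add: pd_psd)
  define t where "t = trace L"
  \<comment> \<open>A sum of nonnegative terms, so one constant dominates each bound separately and
    also \<open>norm (ofd T)\<close>, which needs three of the terms.\<close>
  define B where "B = t + t / \<delta> + t / e + t / f + norm (mat 1 :: real^'n^'n)"
  have t0: "0 \<le> t"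
    using psd_inner_nonneg[OF pd_psd[OF pd_mat_1] pd_psd[OF L]] by (simp add: t_def L_def inner_mat_1)
  then have B0: "0 \<le> t / \<delta>" "0 \<le> t / e" "0 \<le> t / f" "0 \<le> norm (mat 1 :: real^'n^'n)"
    using e f \<delta> by auto
  show thesis
  proof (rule that)
    fix l G T assume q: "(l, G, T) \<in> C0 Shat" and J: "0 \<le> J Shat \<delta> (l, G, T)"
    define La where "La = mat 1 + G - ofd T"
    have l: "0 < l" and La: "psd La" and G: "psd G"
      and sym: "La \<in> sym_mats" "G \<in> sym_mats" "T \<in> sym_mats"
      using q psd_sym by (auto simp: C0_def La_def)
    have dom: "(L, Shat) \<in> primal_dom" using L Shat by (simp add: L_def primal_dom_def pd_sym)
    have "ereal (J Shat \<delta> (l, G, T)) \<le> ereal (lagrangian Shat \<delta> (L, Shat) (l, La, G, T))"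
      unfolding dual_fun_eq_J[OF Shat q, symmetric] La_def[symmetric] dual_fun_def
      by (rule INF_lower[OF dom])
    moreover have "matrix_inv Shat \<bullet> Shat = real CARD('n)"
      using trace_mult_eq_inner[OF pd_sym[OF pd_inverse(1)[OF Shat]], of Shat] pd_inverse(3)[OF Shat]
      by (simp add: trace_I)
    moreover have "Shat - L = e *\<^sub>R mat 1" by (simp add: L_def)
    \<comment> \<open>At \<open>S = Shat\<close> the divergence vanishes, leaving the slack \<delta>
      for \<open>l\<close>; \<open>Shat - L\<close> is a multiple of the identity, which leaves the
      slack \<open>e\<close> for \<open>G\<close> and is orthogonal to \<open>ofd T\<close>.\<close>
    ultimately have ub: "J Shat \<delta> (l, G, T) \<le> t - l * \<delta> - La \<bullet> L - e * trace G"
      unfolding lagrangian_eq_inner[OF Shat sym]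
      by (simp add: inner_commute[of _ "mat 1"] inner_mat_1 trace_ofd t_def)
    have "0 \<le> La \<bullet> L - f * trace La"
      using psd_inner_nonneg[OF La Lf] by (simp add: inner_diff_right inner_commute[of _ "mat 1"] inner_mat_1)
    moreover have nLa: "norm La \<le> trace La" and nG: "norm G \<le> trace G"
      by (rule psd_norm_le_trace[OF La], rule psd_norm_le_trace[OF G])
    moreover have "0 \<le> f * trace La" "0 \<le> e * trace G" "0 \<le> l * \<delta>"
      using e f l \<delta> nLa nG norm_ge_zero[of La] norm_ge_zero[of G]
      by (auto intro!: mult_nonneg_nonneg simp del: norm_ge_zero)
    ultimately have b: "l * \<delta> \<le> t" "e * trace G \<le> t" "f * trace La \<le> t" "J Shat \<delta> (l, G, T) \<le> t"
      using ub J by linarith+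
    then have b': "l \<le> t / \<delta>" "norm G \<le> t / e" "norm La \<le> t / f"
      using e f \<delta> nLa nG by (simp_all add: field_simps) (smt (verit) mult_left_mono)+
    \<comment> \<open>\<open>ofd T\<close> has no sign and gets no direct estimate; it is recovered
      from the two bounded semidefinite multipliers.\<close>
    have "ofd T = mat 1 + G - La" by (simp add: La_def)
    then have "norm (ofd T) \<le> norm (mat 1 :: real^'n^'n) + norm G + norm La"
      using norm_triangle_ineq4[of "mat 1 + G" La] norm_triangle_ineq[of "mat 1 :: real^'n^'n" G]
    by simp
    then show "J Shat \<delta> (l, G, T) \<le> B \<and> l \<le> B \<and> norm G \<le> B \<and> norm (ofd T) \<le> B"
      unfolding B_def using b(4) b' B0 t0 by linarith
  qed
qed

lemma tendsto_ofd: "(X \<longlonglongrightarrow> x) \<Longrightarrow> ((\<lambda>n. ofd (X n)) \<longlonglongrightarrow> ofd (x :: real^'n^'n))"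
proof -
  have "linear (ofd :: real^'n^'n \<Rightarrow> real^'n^'n)"
    by (rule linearI) (simp_all add: ofd_def diag2_add diag2_scale scaleR_diff_right)
  then show "(X \<longlonglongrightarrow> x) \<Longrightarrow> ((\<lambda>n. ofd (X n)) \<longlonglongrightarrow> ofd x)"
    by (rule bounded_linear.tendsto[OF linear_conv_bounded_linear[THEN iffD1]])
qed

text \<open>Continuity of \<open>J\<close> is of no use at a limit outside \<open>C0\<close>. For
  each fixed primal point, however, the Lagrangian is continuous in the multipliers and lies above
  \<open>J\<close> along the sequence, so the supremum \<open>s\<close> carries over to
  \<open>dual_fun\<close> at the limit.\<close>

lemma J_attains_max:
  fixes Shat :: "real^'n^'n"
  assumes Shat: "pd Shat" and \<delta>: "0 < \<delta>" "\<delta> < delta_max Shat"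
  obtains q where "q \<in> C0 Shat" "\<And>q'. q' \<in> C0 Shat \<Longrightarrow> J Shat \<delta> q' \<le> J Shat \<delta> q"
proof -
  obtain q0 where q0: "q0 \<in> C0 Shat" "0 < J Shat \<delta> q0" using J_pos_exists[OF Shat \<delta>(2)] .
  obtain B where B: "\<And>l G T. (l, G, T) \<in> C0 Shat \<Longrightarrow> 0 \<le> J Shat \<delta> (l, G, T) \<Longrightarrow>
    J Shat \<delta> (l, G, T) \<le> B \<and> l \<le> B \<and> norm G \<le> B \<and> norm (ofd T) \<le> B"
    using superlevel_bounded[OF Shat \<delta>(1)] by blast
  define s where "s = (SUP q\<in>C0 Shat. J Shat \<delta> q)"
  \<comment> \<open>\<open>B\<close> is available only where \<open>J\<close> is nonnegative, hence
    the maximum with 0.\<close>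
  have "J Shat \<delta> q \<le> max B 0" if "q \<in> C0 Shat" for q
    using B that by (cases q) (metis linear max.coboundedI1 max.coboundedI2)
  then have bdd: "bdd_above (J Shat \<delta> ` C0 Shat)" by (rule bdd_aboveI2)
  have le_s: "J Shat \<delta> q \<le> s" if "q \<in> C0 Shat" for q
    unfolding s_def by (rule cSUP_upper[OF that bdd])
  have s: "0 < s" using q0(2) le_s[OF q0(1)] by simp
  \<comment> \<open>The gap tends to 0 and never exceeds \<open>s\<close>, so already the first term
    has nonnegative \<open>J\<close> and the bounds \<open>B\<close> hold along the whole
    sequence.\<close>
  have "\<exists>q\<in>C0 Shat. s - s / (Suc n + 1) < J Shat \<delta> q" for n
    using less_cSUP_iff[OF _ bdd, of "s - s / (Suc n + 1)"] q0(1) s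
    unfolding s_def[symmetric] by (auto simp: field_simps)
  then obtain q where q: "\<And>n. q n \<in> C0 Shat" "\<And>n. s - s / (Suc n + 1) < J Shat \<delta> (q n)" by metis
  define l where "l n = fst (q n)" for n
  define G where "G n = fst (snd (q n))" for n
  define T where "T n = snd (snd (q n))" for n
  \<comment> \<open>The diagonals of \<open>T n\<close> may diverge; discarding them changes neither
    membership in \<open>C0\<close> nor the value of \<open>J\<close>.\<close>
  define X where "X n = ofd (T n)" for n
  have X_ofd: "ofd (X n) = X n" for n by (simp add: X_def ofd_ofd)
  have q_eq: "q n = (l n, G n, T n)" for n by (simp add: l_def G_def T_def)
  have C: "(l n, G n, X n) \<in> C0 Shat" for n
    using q(1)[of n] unfolding q_eq[of n] by (auto simp: C0_def X_def ofd_ofd ofd_sym)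
  have Jq: "s - s / (Suc n + 1) < J Shat \<delta> (l n, G n, X n)" for n
    using q(2)[of n] unfolding q_eq[of n] J_def by (simp add: X_def ofd_ofd)
  have "s / (Suc n + 1) \<le> s" for n using s by (simp add: field_simps)
  then have "0 \<le> J Shat \<delta> (l n, G n, X n)" for n using Jq[of n] by (smt (verit))
  then have bounds: "l n \<le> B" "norm (G n) \<le> B" "norm (X n) \<le> B" for n
    using B[OF C] X_ofd by metis+
  define K where "K = {0..B} \<times> cball (0 :: real^'n^'n) B \<times> cball (0 :: real^'n^'n) B"
  have inK: "\<forall>n. (l n, G n, X n) \<in> K"
    using bounds C by (simp add: K_def C0_def less_imp_le)
  have "compact K"
    unfolding K_def by (intro compact_Times compact_cball compact_Icc)
  from this[unfolded compact_def, THEN spec, of "\<lambda>n. (l n, G n, X n)"] inK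
  obtain y r where r: "strict_mono r" and lim: "((\<lambda>n. (l n, G n, X n)) \<circ> r) \<longlonglongrightarrow> y"
    by blast
  obtain l' G' X' where y: "y = (l', G', X')" by (cases y)
  have liml: "(\<lambda>n. l (r n)) \<longlonglongrightarrow> l'" and limG: "(\<lambda>n. G (r n)) \<longlonglongrightarrow> G'"
    and limX: "(\<lambda>n. X (r n)) \<longlonglongrightarrow> X'"
    using tendsto_fst[OF lim] tendsto_fst[OF tendsto_snd[OF lim]] tendsto_snd[OF tendsto_snd[OF lim]]
    by (simp_all add: y o_def)
  have X': "ofd X' = X'"
    using LIMSEQ_unique[OF tendsto_ofd[OF limX]] limX by (simp add: X_ofd)
  have l': "0 \<le> l'" using C by (intro LIMSEQ_le_const[OF liml]) (auto simp: C0_def less_imp_le)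
  have G': "psd G'" using closed_sequentially[OF closed_psd _ limG] C by (auto simp: C0_def)
  have X'sym: "X' \<in> sym_mats"
    using closed_sequentially[OF closed_subspace[OF subspace_sym_mats] _ limX] C
    by (auto simp: C0_def)
  have "(\<lambda>n. mat 1 + G (r n) - X (r n)) \<longlonglongrightarrow> mat 1 + G' - X'"
    by (intro tendsto_intros limG limX)
  from closed_sequentially[OF closed_psd _ this]
  have La': "psd (mat 1 + G' - X')" using C by (simp add: C0_def X_ofd)
  \<comment> \<open>Only the non-strict conditions pass to the limit: so far \<open>l'\<close> may
    be 0 and definiteness may be lost.\<close>
  have m': "(l', mat 1 + G' - X', G', X') \<in> multipliers"
    using l' G' X'sym La' by (simp add: multipliers_def)
  have lim_s: "(\<lambda>n. s - s / (Suc (r n) + 1)) \<longlonglongrightarrow> s"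
  proof -
    have "(\<lambda>n. s - s * inverse (real (Suc n))) \<longlonglongrightarrow> s - s * 0"
      by (intro tendsto_intros LIMSEQ_inverse_real_of_nat)
    from LIMSEQ_subseq_LIMSEQ[OF LIMSEQ_Suc[OF this] r]
    show ?thesis by (simp add: o_def divide_inverse add_ac)
  qed
  have "s \<le> lagrangian Shat \<delta> p (l', mat 1 + G' - X', G', X')" if p: "p \<in> primal_dom" for p
  proof (rule LIMSEQ_le[OF lim_s])
    obtain L S where p_eq: "p = (L, S)" by (cases p)
    have "lagrangian Shat \<delta> p (l (r n), mat 1 + G (r n) - X (r n), G (r n), X (r n)) =
      trace L + l (r n) * (- ln (det S) + ln (det Shat) - real CARD('n) + matrix_inv Shat \<bullet> S - \<delta>)
      - (mat 1 + G (r n) - X (r n)) \<bullet> L - G (r n) \<bullet> (S - L) + X (r n) \<bullet> (S - L)" for n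
      using C[of "r n"] unfolding p_eq
      by (subst lagrangian_eq_inner[OF Shat]) (auto simp: C0_def X_ofd psd_sym)
    moreover have "lagrangian Shat \<delta> p (l', mat 1 + G' - X', G', X') =
      trace L + l' * (- ln (det S) + ln (det Shat) - real CARD('n) + matrix_inv Shat \<bullet> S - \<delta>)
      - (mat 1 + G' - X') \<bullet> L - G' \<bullet> (S - L) + X' \<bullet> (S - L)"
      unfolding p_eq
      by (subst lagrangian_eq_inner[OF Shat]) (auto simp: X' X'sym psd_sym La' G')
    ultimately show "(\<lambda>n. lagrangian Shat \<delta> p (l (r n), mat 1 + G (r n) - X (r n), G (r n), X (r n)))
        \<longlonglongrightarrow> lagrangian Shat \<delta> p (l', mat 1 + G' - X', G', X')"
      by (simp only:) (intro tendsto_intros liml limG limX)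
    have "s - s / (Suc (r n) + 1) \<le>
        lagrangian Shat \<delta> p (l (r n), mat 1 + G (r n) - X (r n), G (r n), X (r n))" for n
    proof -
      have "ereal (J Shat \<delta> (l (r n), G (r n), X (r n))) \<le>
          ereal (lagrangian Shat \<delta> p (l (r n), mat 1 + G (r n) - ofd (X (r n)), G (r n), X (r n)))"
        unfolding dual_fun_eq_J[OF Shat C, symmetric] dual_fun_def by (rule INF_lower[OF p])
      then show ?thesis using Jq[of "r n"] by (simp add: X_ofd)
    qed
    then show "\<exists>N. \<forall>n\<ge>N. s - s / (Suc (r n) + 1) \<le>
        lagrangian Shat \<delta> p (l (r n), mat 1 + G (r n) - X (r n), G (r n), X (r n))" by blast
  qed
  then have D: "ereal s \<le> dual_fun Shat \<delta> (l', mat 1 + G' - X', G', X')"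
    unfolding dual_fun_def by (intro INF_greatest) simp
  have "l' \<noteq> 0"
  proof
    assume "l' = 0"
    then have "ereal s \<le> 0"
      using dual_fun_zero_multiplier[OF Shat] m' D order_trans by blast
    then show False using s by simp
  qed
  \<comment> \<open>For \<open>l' > 0\<close> a point outside \<open>C0\<close> would have dual
    value \<open>- \<infinity>\<close>, which is below \<open>s\<close>.\<close>
  then have "(l', G', X') \<in> C0 Shat" "s \<le> J Shat \<delta> (l', G', X')"
    using dual_fun_pos_multiplier[OF Shat m', of \<delta>] l' D by (auto split: if_splits)
  then show thesis using that le_s order_trans by blast
qed

text \<open>A dual problem depends on the chosen Lagrangian, so the first conjunct ties that
  Lagrangian to the primal constraints. Equal suprema would not compare optimizers, hence the
  separate equivalence; the existence claim prevents it from holding vacuously.\<close>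

theorem mainTheorem1:
  fixes Shat :: "real^'n^'n" and \<delta> :: real
  assumes "Shat \<in> sym_mats" and "pd Shat"
    and "0 < \<delta>" and "\<delta> < delta_max Shat"
  shows
    "(\<forall>p\<in>primal_dom. (SUP m\<in>multipliers. ereal (lagrangian Shat \<delta> p m)) =
        (if p \<in> primal_feasible Shat \<delta> then ereal (primal_obj p) else \<infinity>))
     \<and>
     (\<forall>l La G T. (l, La, G, T) \<in> multipliers \<longrightarrow> 0 < l \<longrightarrow>
        dual_fun Shat \<delta> (l, La, G, T) =
          (if (l, G, T) \<in> C0 Shat \<and> La = mat 1 + G - ofd T
           then ereal (J Shat \<delta> (l, G, T)) else - \<infinity>))
     \<and>
     (SUP m\<in>multipliers. dual_fun Shat \<delta> m) = (SUP q\<in>C0 Shat. ereal (J Shat \<delta> q))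
     \<and>
     (\<forall>l La G T.
        is_arg_max (dual_fun Shat \<delta>) (\<lambda>m. m \<in> multipliers) (l, La, G, T) \<longleftrightarrow>
        is_arg_max (J Shat \<delta>) (\<lambda>q. q \<in> C0 Shat) (l, G, T) \<and> La = mat 1 + G - ofd T)
     \<and>
     (\<exists>q. is_arg_max (J Shat \<delta>) (\<lambda>q. q \<in> C0 Shat) q)"
proof -
  have Shat: "pd Shat" by fact
  have dual_pos: "dual_fun Shat \<delta> (l, La, G, T) =
      (if (l, G, T) \<in> C0 Shat \<and> La = mat 1 + G - ofd T
       then ereal (J Shat \<delta> (l, G, T)) else - \<infinity>)"
    if "(l, La, G, T) \<in> multipliers" "0 < l" for l La G T
    using dual_fun_pos_multiplier[OF Shat that] .
  obtain q0 where q0: "q0 \<in> C0 Shat" "0 < J Shat \<delta> q0"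
    using J_pos_exists[OF Shat \<open>\<delta> < delta_max Shat\<close>] .
  \<comment> \<open>This dichotomy covers \<open>l = 0\<close> by an upper bound alone. Since
    \<open>q0\<close> has positive \<open>J\<close>, multipliers of the first kind neither raise the
    supremum nor maximize.\<close>
  have dual_cases: "dual_fun Shat \<delta> (l, La, G, T) \<le> 0 \<or>
      (l, G, T) \<in> C0 Shat \<and> La = mat 1 + G - ofd T"
    if m: "(l, La, G, T) \<in> multipliers" for l La G T
  proof (cases "l = 0")
    case True
    then show ?thesis using dual_fun_zero_multiplier[OF Shat] m by blast
  next
    case False
    then have "0 < l" using m by (simp add: multipliers_def)
    from dual_pos[OF m this] show ?thesis by (auto split: if_splits)
  qed
  have dual_C0: "(l, mat 1 + G - ofd T, G, T) \<in> multipliers"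
      "dual_fun Shat \<delta> (l, mat 1 + G - ofd T, G, T) = ereal (J Shat \<delta> (l, G, T))"
    if "(l, G, T) \<in> C0 Shat" for l G T
    using C0_multiplier[OF that] dual_fun_eq_J[OF Shat that] by auto
  have "(SUP m\<in>multipliers. dual_fun Shat \<delta> m) = (SUP q\<in>C0 Shat. ereal (J Shat \<delta> q))"
  proof (rule antisym)
    show "(SUP m\<in>multipliers. dual_fun Shat \<delta> m) \<le> (SUP q\<in>C0 Shat. ereal (J Shat \<delta> q))"
    proof (rule SUP_least)
      fix m :: "real \<times> (real^'n^'n) \<times> (real^'n^'n) \<times> (real^'n^'n)"
      assume "m \<in> multipliers"
      moreover obtain l La G T where m: "m = (l, La, G, T)" by (cases m)
      ultimately consider "dual_fun Shat \<delta> m \<le> 0" | "(l, G, T) \<in> C0 Shat" "La = mat 1 + G - ofd T"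
        using dual_cases by blast
      then show "dual_fun Shat \<delta> m \<le> (SUP q\<in>C0 Shat. ereal (J Shat \<delta> q))"
      proof cases
        case 1
        also have "0 \<le> ereal (J Shat \<delta> q0)" using q0(2) by simp
        finally show ?thesis by (rule SUP_upper2[OF q0(1)])
      next
        case 2
        then show ?thesis unfolding m by (intro SUP_upper2[OF 2(1)]) (simp add: dual_C0)
      qed
    qed
    show "(SUP q\<in>C0 Shat. ereal (J Shat \<delta> q)) \<le> (SUP m\<in>multipliers. dual_fun Shat \<delta> m)"
    proof (rule SUP_least)
      fix q assume "q \<in> C0 Shat"
      moreover obtain l G T where q: "q = (l, G, T)" by (cases q)
      ultimately have C: "(l, G, T) \<in> C0 Shat" by simp
      show "ereal (J Shat \<delta> q) \<le> (SUP m\<in>multipliers. dual_fun Shat \<delta> m)"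
        unfolding q dual_C0(2)[OF C, symmetric] by (rule SUP_upper[OF dual_C0(1)[OF C]])
    qed
  qed
  moreover have "is_arg_max (dual_fun Shat \<delta>) (\<lambda>m. m \<in> multipliers) (l, La, G, T) \<longleftrightarrow>
      is_arg_max (J Shat \<delta>) (\<lambda>q. q \<in> C0 Shat) (l, G, T) \<and> La = mat 1 + G - ofd T"
    (is "?D \<longleftrightarrow> ?P") for l La G T
  proof
    assume D: ?D
    then have m: "(l, La, G, T) \<in> multipliers"
      and max: "\<And>m. m \<in> multipliers \<Longrightarrow> dual_fun Shat \<delta> m \<le> dual_fun Shat \<delta> (l, La, G, T)"
      by (auto simp: is_arg_max_def not_less)
    have max_C0: "ereal (J Shat \<delta> q) \<le> dual_fun Shat \<delta> (l, La, G, T)" if "q \<in> C0 Shat" for q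
      using that max dual_C0 by (cases q) metis
    have "0 < ereal (J Shat \<delta> q0)" using q0(2) by simp
    also have "\<dots> \<le> dual_fun Shat \<delta> (l, La, G, T)" by (rule max_C0[OF q0(1)])
    finally have "(l, G, T) \<in> C0 Shat" "La = mat 1 + G - ofd T"
      using dual_cases[OF m] by auto
    moreover from this have "J Shat \<delta> q \<le> J Shat \<delta> (l, G, T)" if "q \<in> C0 Shat" for q
      using max_C0[OF that] by (simp add: dual_C0(2))
    ultimately show ?P unfolding is_arg_max_def by (auto simp: not_less)
  next
    assume P: ?P
    then have C: "(l, G, T) \<in> C0 Shat" and La: "La = mat 1 + G - ofd T"
      and max: "\<And>q. q \<in> C0 Shat \<Longrightarrow> J Shat \<delta> q \<le> J Shat \<delta> (l, G, T)"
      by (auto simp: is_arg_max_def not_less)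
    have "dual_fun Shat \<delta> m \<le> dual_fun Shat \<delta> (l, La, G, T)" if m': "m \<in> multipliers" for m
    proof -
      obtain l' La' G' T' where m: "m = (l', La', G', T')" by (cases m)
      have pos: "0 \<le> ereal (J Shat \<delta> (l, G, T))" using max[OF q0(1)] q0(2) by simp
      consider "dual_fun Shat \<delta> m \<le> 0" | "(l', G', T') \<in> C0 Shat" "La' = mat 1 + G' - ofd T'"
        using dual_cases[OF m'[unfolded m]] m by blast
      then have "dual_fun Shat \<delta> m \<le> ereal (J Shat \<delta> (l, G, T))"
      proof cases
        case 1
        then show ?thesis using pos by (rule order_trans)
      next
        case 2
        then show ?thesis by (simp add: m dual_C0 max)
      qed
      then show ?thesis by (simp add: La dual_C0(2)[OF C])
    qed
    then show ?D unfolding is_arg_max_def using dual_C0(1)[OF C] La by (auto simp: not_less)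
  qed
  moreover have "\<exists>q. is_arg_max (J Shat \<delta>) (\<lambda>q. q \<in> C0 Shat) q"
    using J_attains_max[OF Shat \<open>0 < \<delta>\<close> \<open>\<delta> < delta_max Shat\<close>]
    unfolding is_arg_max_def by (metis not_less)
  ultimately show ?thesis using SUP_lagrangian[OF Shat] dual_pos by blast
qed

end
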